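(* Let the kernel pair $(M(x),K(x))$ belong to the Luchko set $\mathcal{L}_1(\mathbb{R}_+)$ and let $-\infty<a<b<+\infty$. Then the parametric general fractional integral and the parametric general fractional derivative of Caputo type satisfy the equalities $$(I^{(M)}_{a+,g}\,D^{(K),*}_{a+,g}f)(x)=f(x)-f(a),$$ if $f\in C^1_{-1,g}(a,b]$ and $g\in\mathcal{G}(a,b]$, and $$(I^{(M)}_{b-,g}\,D^{(K),*}_{b-,g}f)(x)=f(b)-f(x),$$ if $f\in C^1_{-1,g}[a,b)$ and $g\in\mathcal{G}[a,b)$.
   Context: Function classes. $\mathcal{G}(a,b]$ (resp. $\mathcal{G}[a,b)$) is the set of increasing and positive monotone functions $g$ on $(a,b)$ having a continuous first-order derivative $g^{(1)}$ on $(a,b]$ (resp. on $[a,b)$) such that $g^{(1)}(x)\ne0$ for all $x\in[a,b]$. $f\in C^1_{-1,g}(a,b]$ means that the first-order derivative of $f$ can be represented as $f^{(1)}(x)=(g(x)-g(a))^p\,v_p(x)$ with $v_p\in C[a,b]$ and $p>-1$. $f\in C^1_{-1,g}[a,b)$ means that $f^{(1)}(x)=(g(b)-g(x))^q\,v_q(x)$ with $v_q\in C[a,b]$ and $q>-1$. Kernels. The Luchko set $\mathcal{L}_1(\mathbb{R}_+)$ consists of the pairs $(M(x),K(x))$, $x\in\mathbb{R}_+=(0,\infty)$, such that $M,K\in C_{-1}(0,b-a]$ and the Sonin condition holds: $$\int_0^x M(x-z)K(z)\,dz=\begin{cases}1,& x\in(0,b-a],\\ 0,& x\notin(0,b-a].\end{cases}$$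 Here $F\in C_{-1}(0,b-a]$ means $F(x)=x^pG(x)$ for some $G\in C[0,b-a]$ and $p>-1$. Operators. For $a<x\le b$ (left-sided) and $a\le x<b$ (right-sided): $$(I^{(M)}_{a+,g}f)(x)=\int_a^x M(g(x)-g(u))f(u)g^{(1)}(u)\,du,\qquad (I^{(M)}_{b-,g}f)(x)=\int_x^b M(g(u)-g(x))f(u)g^{(1)}(u)\,du,$$ $$(D^{(K),*}_{a+,g}f)(x)=\int_a^x K(g(x)-g(u))f^{(1)}(u)\,du,\qquad (D^{(K),*}_{b-,g}f)(x)=-\int_x^b K(g(u)-g(x))f^{(1)}(u)\,du.$$
   Formalization: The right-sided identity is proved with f(x)−f(b), since the printed sign is wrong; the Sonin condition is on (0,L] with g(b)−g(a) ≤ L required instead of (0,b−a]; f is assumed continuous on [a,b] so that f(a), f(b) are meaningful. *)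

theory Defs
  imports "HOL-Analysis.Analysis"
begin

definition C_minus1 :: "real \<Rightarrow> (real \<Rightarrow> real) set" where
  "C_minus1 L = {F. \<exists>p>-1. \<exists>G. continuous_on {0..L} G \<and> (\<forall>x\<in>{0<..L}. F x = x powr p * G x)}"

(* The kernels of the parametric operators are evaluated at differences of values of g, so the
   length L of the interval carrying the kernels is a parameter, to be compared with g b - g a. *)
definition luchko_set :: "real \<Rightarrow> ((real \<Rightarrow> real) \<times> (real \<Rightarrow> real)) set" where
  "luchko_set L = {(M, K). M \<in> C_minus1 L \<and> K \<in> C_minus1 L \<and>
     (\<forall>x. set_integrable lborel {0<..<x} (\<lambda>z. M (x - z) * K z) \<and>
          (LBINT z:{0<..<x}. M (x - z) * K z) = (if x \<in> {0<..L} then 1 else 0))}"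

(* The derivative g' has no zero on the closed interval, so it must exist at both end points
   (as a one-sided derivative), although its continuity is only required on the half-open
   interval. In particular g is continuous on {a..b}. *)
definition G_left :: "real \<Rightarrow> real \<Rightarrow> (real \<Rightarrow> real) set" where
  "G_left a b = {g. mono_on {a<..<b} g \<and> (\<forall>x\<in>{a<..<b}. g x > 0) \<and>
     (\<exists>g'. (\<forall>x\<in>{a..b}. (g has_real_derivative g' x) (at x within {a..b})) \<and>
           continuous_on {a<..b} g' \<and> (\<forall>x\<in>{a..b}. g' x \<noteq> 0))}"

definition G_right :: "real \<Rightarrow> real \<Rightarrow> (real \<Rightarrow> real) set" where
  "G_right a b = {g. mono_on {a<..<b} g \<and> (\<forall>x\<in>{a<..<b}. g x > 0) \<and>
     (\<exists>g'. (\<forall>x\<in>{a..b}. (g has_real_derivative g' x) (at x within {a..b})) \<and>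
           continuous_on {a..<b} g' \<and> (\<forall>x\<in>{a..b}. g' x \<noteq> 0))}"

(* The representation of the derivative only concerns the half-open interval. Continuity of f on
   {a..b} makes the value of f at the excluded end point the one-sided limit there. *)
definition C1_minus1_left :: "(real \<Rightarrow> real) \<Rightarrow> real \<Rightarrow> real \<Rightarrow> (real \<Rightarrow> real) set" where
  "C1_minus1_left g a b = {f. continuous_on {a..b} f \<and>
     (\<exists>p>-1. \<exists>v. continuous_on {a..b} v \<and>
       (\<forall>x\<in>{a<..b}. (f has_real_derivative (g x - g a) powr p * v x) (at x within {a..b})))}"

definition C1_minus1_right :: "(real \<Rightarrow> real) \<Rightarrow> real \<Rightarrow> real \<Rightarrow> (real \<Rightarrow> real) set" where
  "C1_minus1_right g a b = {f. continuous_on {a..b} f \<and>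
     (\<exists>q>-1. \<exists>v. continuous_on {a..b} v \<and>
       (\<forall>x\<in>{a..<b}. (f has_real_derivative (g b - g x) powr q * v x) (at x within {a..b})))}"

(* Integration is over open intervals, where the two-sided derivatives exist. *)
definition GFI_left ::
    "(real \<Rightarrow> real) \<Rightarrow> real \<Rightarrow> (real \<Rightarrow> real) \<Rightarrow> (real \<Rightarrow> real) \<Rightarrow> real \<Rightarrow> real" where
  "GFI_left M a g f x = (LBINT u:{a<..<x}. M (g x - g u) * f u * deriv g u)"

definition GFI_right ::
    "(real \<Rightarrow> real) \<Rightarrow> real \<Rightarrow> (real \<Rightarrow> real) \<Rightarrow> (real \<Rightarrow> real) \<Rightarrow> real \<Rightarrow> real" where
  "GFI_right M b g f x = (LBINT u:{x<..<b}. M (g u - g x) * f u * deriv g u)"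

definition GFD_Caputo_left ::
    "(real \<Rightarrow> real) \<Rightarrow> real \<Rightarrow> (real \<Rightarrow> real) \<Rightarrow> (real \<Rightarrow> real) \<Rightarrow> real \<Rightarrow> real" where
  "GFD_Caputo_left K a g f x = (LBINT u:{a<..<x}. K (g x - g u) * deriv f u)"

definition GFD_Caputo_right ::
    "(real \<Rightarrow> real) \<Rightarrow> real \<Rightarrow> (real \<Rightarrow> real) \<Rightarrow> (real \<Rightarrow> real) \<Rightarrow> real \<Rightarrow> real" where
  "GFD_Caputo_right K b g f x = - (LBINT u:{x<..<b}. K (g u - g x) * deriv f u)"

end

theory Submission
  imports Defs
begin

text \<open>
  Exchanging the order of integration, the substitution \<open>s = g u\<close> turns the inner integral into
  the Sonin integral of the kernels over an interval of length \<open>g x - g t\<close>, which is 1, so that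
  the integral of \<open>deriv f\<close> remains. For Fubini's theorem, the Beta integral gives
  \<open>\<integral> \<bar>M (y - z) * K z\<bar> dz \<le> C * y powr s\<close> with \<open>s > -1\<close>. Since \<open>g\<close> has nonzero derivatives at
  the end points, \<open>g x - g t\<close> and \<open>g t - g a\<close> are comparable with \<open>x - t\<close> and \<open>t - a\<close>, and the
  double integral is dominated by a second Beta integral. The right-sided identity is the
  left-sided one for \<open>\<lambda>w. - g (- w)\<close> and \<open>\<lambda>w. f (- w)\<close>.
\<close>

section \<open>Kernel bounds and comparison of powers\<close>

lemma C_minus1_bound:
  assumes "F \<in> C_minus1 L"
  obtains p C where "p > -1" "C \<ge> 0" "\<And>z. z \<in> {0<..L} \<Longrightarrow> \<bar>F z\<bar> \<le> C * z powr p"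
proof -
  obtain p G where p: "p > -1" and G: "continuous_on {0..L} G"
    and F: "\<And>x. x \<in> {0<..L} \<Longrightarrow> F x = x powr p * G x"
    using assms unfolding C_minus1_def by blast
  have "bounded (G ` {0..L})"
    using G compact_continuous_image compact_imp_bounded by blast
  then obtain C where C: "\<And>x. x \<in> {0..L} \<Longrightarrow> \<bar>G x\<bar> \<le> C" "C > 0"
    unfolding bounded_pos by (metis image_eqI real_norm_def)
  have "\<bar>F z\<bar> \<le> C * z powr p" if "z \<in> {0<..L}" for z
    using C(1)[of z] that by (auto simp: F abs_mult mult.commute intro!: mult_right_mono)
  then show thesis using p C(2) by (intro that[of p C]) auto
qed

lemma C_minus1_measurable:
  assumes "F \<in> C_minus1 L"
  shows "(\<lambda>z. indicator {0<..L} z * F z) \<in> borel_measurable borel"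
proof -
  obtain p G where G: "continuous_on {0..L} G"
    and F: "\<And>x. x \<in> {0<..L} \<Longrightarrow> F x = x powr p * G x"
    using assms unfolding C_minus1_def by blast
  have "continuous_on {0<..L} (\<lambda>x. x powr p * G x)"
    by (intro continuous_intros continuous_on_subset[OF G]) auto
  then have "continuous_on {0<..L} F"
    by (rule continuous_on_eq) (simp add: F)
  then show ?thesis
    using borel_measurable_continuous_on_indicator[of "{0<..L}" F] by simp
qed

text \<open>The power function is increasing for \<open>s >= 0\<close> and decreasing for
  \<open>s < 0\<close>, so the upper bound on \<open>z\<close> decides one case and the lower bound
  the other. Adding the two constants gives one estimate whatever the sign of the exponent.\<close>

lemma powr_le_powr_of_comparable:
  fixes y z m B s :: real
  assumes "0 < m" "0 < y" "m * y \<le> z" "z \<le> B * y"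
  shows "z powr s \<le> (m powr s + B powr s) * y powr s"
proof -
  have "0 < z" "0 < B"
    using assms by (smt (verit, best) mult_pos_pos zero_less_mult_pos2)+
  show ?thesis
  proof (cases "s \<ge> 0")
    case True
    then have "z powr s \<le> (B * y) powr s"
      using assms \<open>0 < z\<close> by (intro powr_mono2) auto
    also have "\<dots> \<le> (m powr s + B powr s) * y powr s"
      using assms \<open>0 < B\<close> by (simp add: powr_mult algebra_simps)
    finally show ?thesis .
  next
    case False
    then have "z powr s \<le> (m * y) powr s"
      using assms \<open>0 < z\<close> by (intro powr_mono2') auto
    also have "\<dots> \<le> (m powr s + B powr s) * y powr s"
      using assms \<open>0 < B\<close> by (simp add: powr_mult algebra_simps)
    finally show ?thesis .
  qed
qed

text \<open>The difference quotient at \<open>c\<close>, extended by the value \<open>D\<close>, is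
  continuous and positive on a compact interval; its minimum and maximum serve as \<open>m\<close>
  and \<open>B\<close>. Only the derivative at \<open>c\<close> itself enters, so the bounds also
  hold at an end point where the derivative of \<open>g\<close> is discontinuous.\<close>

lemma slope_bounds:
  fixes g :: "real \<Rightarrow> real"
  assumes "c \<in> {a..b}" "continuous_on {a..b} g" "strict_mono_on {a..b} g"
    and D: "(g has_real_derivative D) (at c within {a..b})" "D > 0"
  obtains m B where "m > 0" "\<And>t. t \<in> {a..b} \<Longrightarrow> m * \<bar>t - c\<bar> \<le> \<bar>g t - g c\<bar>"
    "\<And>t. t \<in> {a..b} \<Longrightarrow> \<bar>g t - g c\<bar> \<le> B * \<bar>t - c\<bar>"
proof -
  define q where "q = (\<lambda>t. if t = c then D else (g t - g c) / (t - c))"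
  have gq: "g t - g c = q t * (t - c)" for t
    by (simp add: q_def)
  have q_pos: "q t > 0" if "t \<in> {a..b}" for t
  proof (cases t c rule: linorder_cases)
    case less
    then have "g t < g c" using assms that by (auto simp: strict_mono_on_def)
    with less show ?thesis by (auto simp: q_def intro: divide_neg_neg)
  next
    case greater
    then have "g c < g t" using assms that by (auto simp: strict_mono_on_def)
    with greater show ?thesis by (simp add: q_def)
  qed (simp add: q_def D)
  have "continuous_on {a..b} q"
    unfolding continuous_on_def
  proof
    fix t assume t: "t \<in> {a..b}"
    show "(q \<longlongrightarrow> q t) (at t within {a..b})"
    proof (cases "t = c")
      case True
      have "((\<lambda>t. (g t - g c) / (t - c)) \<longlongrightarrow> D) (at c within {a..b})"
        using D(1) by (simp add: has_field_derivative_iff)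
      then have "(q \<longlongrightarrow> D) (at c within {a..b})"
        by (rule Lim_transform_eventually) (auto simp: q_def eventually_at_filter)
      then show ?thesis using True by (simp add: q_def)
    next
      case False
      have "((\<lambda>t. (g t - g c) / (t - c)) \<longlongrightarrow> (g t - g c) / (t - c)) (at t within {a..b})"
        using assms(2) t False by (auto simp: continuous_on_def intro!: tendsto_intros)
      moreover have "\<forall>\<^sub>F s in at t within {a..b}. (g s - g c) / (s - c) = q s"
        using tendsto_imp_eventually_ne[OF tendsto_ident_at False]
        by (rule eventually_mono) (simp add: q_def)
      ultimately have "(q \<longlongrightarrow> (g t - g c) / (t - c)) (at t within {a..b})"
        by (rule Lim_transform_eventually)
      then show ?thesis
        using False by (simp add: q_def)
    qed
  qed
  then obtain t1 t2 where "t1 \<in> {a..b}" "\<And>t. t \<in> {a..b} \<Longrightarrow> q t1 \<le> q t"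
    "\<And>t. t \<in> {a..b} \<Longrightarrow> q t \<le> q t2"
    using continuous_attains_inf[of "{a..b}" q] continuous_attains_sup[of "{a..b}" q] assms(1)
    by (metis compact_Icc empty_iff)
  then show thesis
    using that[of "q t1" "q t2"] q_pos
    by (simp add: gq abs_mult mult_right_mono abs_of_pos)
qed

section \<open>Beta integrals and substitution for Lebesgue integrals\<close>

text \<open>Scaling \<open>z = y * t\<close> reduces the claim to the Beta integral over the unit
  interval.\<close>

lemma beta_integrable:
  fixes p q y :: real
  assumes "p > -1" "q > -1" "y > 0"
  shows "integrable lborel (\<lambda>z. indicator {0<..<y} z * ((y - z) powr p * z powr q))"
    and "(\<integral>z. indicator {0<..<y} z * ((y - z) powr p * z powr q) \<partial>lborel)
          = Beta (q + 1) (p + 1) * y powr (p + q + 1)"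
proof -
  let ?h = "\<lambda>t::real. indicator {0<..<1} t * ((1 - t) powr p * t powr q)"
  let ?k = "\<lambda>z. indicator {0<..<y} z * ((y - z) powr p * z powr q)"
  have "((\<lambda>t. t powr q * (1 - t) powr p) has_integral Beta (q + 1) (p + 1)) {0<..<1}"
    using has_integral_Beta_real[of "q + 1" "p + 1"] assms by (simp add: has_integral_Icc_iff_Ioo)
  then have hi: "(?h has_integral Beta (q + 1) (p + 1)) UNIV"
    by (subst (asm) has_integral_restrict_UNIV[symmetric])
       (auto elim!: has_integral_eq[rotated] simp: indicator_def)
  have [measurable]: "?h \<in> borel_measurable borel" by measurable
  have h: "integrable lborel ?h" "integral\<^sup>L lborel ?h = Beta (q + 1) (p + 1)"
  proof -
    have "?h absolutely_integrable_on UNIV"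
      using hi by (intro nonnegative_absolutely_integrable_1) (auto simp: has_integral_integrable)
    then show 1: "integrable lborel ?h"
      by (simp add: set_integrable_def integrable_completion)
    show "integral\<^sup>L lborel ?h = Beta (q + 1) (p + 1)"
      using has_integral_unique[OF has_integral_integral_lborel[OF 1] hi] .
  qed
  \<comment> \<open>The two powers contribute \<open>y powr (p + q)\<close>; the last factor
    \<open>y\<close> of the final formula is the Jacobian of the scaling. The summand 0 gives the
    argument the shape of a general affine map.\<close>
  have kh: "?k (0 + y * t) = y powr (p + q) * ?h t" for t
  proof (cases "t \<in> {0<..<1}")
    case True
    then have "(y - y * t) powr p = y powr p * (1 - t) powr p"
      using assms by (subst powr_mult[symmetric]) (auto simp: algebra_simps)
    then show ?thesis
      using True assms by (simp add: powr_mult powr_add indicator_def)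
  next
    case False
    then have "y * t \<notin> {0<..<y}" using assms by (auto simp: zero_less_mult_iff)
    then show ?thesis using False by simp
  qed
  have "integrable lborel (\<lambda>t. ?k (0 + y * t))"
    unfolding kh using h by simp
  then show "integrable lborel ?k"
    using assms by (subst (asm) lborel_integrable_real_affine_iff) auto
  have "integral\<^sup>L lborel ?k = y * (\<integral>t. ?k (0 + y * t) \<partial>lborel)"
    using assms by (subst lborel_integral_real_affine[of y _ 0]) auto
  also have "\<dots> = Beta (q + 1) (p + 1) * y powr (p + q + 1)"
    unfolding kh using h assms by (simp add: powr_add)
  finally show "integral\<^sup>L lborel ?k = Beta (q + 1) (p + 1) * y powr (p + q + 1)" .
qed

text \<open>The change of variables theorem speaks of absolute integrability with respect to the
  completed measure. Assumption \<open>meas\<close> supplies the Borel measurability for the return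
  to \<open>lborel\<close>, and since \<open>F\<close> vanishes outside the image interval, its
  integral there is the one over the whole line.\<close>

lemma lborel_substitution:
  fixes g F :: "real \<Rightarrow> real"
  assumes der: "\<And>x. x \<in> {a<..<b} \<Longrightarrow> (g has_real_derivative g' x) (at x)"
    and pos: "\<And>x. x \<in> {a<..<b} \<Longrightarrow> g' x \<ge> 0"
    and inj: "inj_on g {a<..<b}" and img: "g ` {a<..<b} = {c<..<d}"
    and F: "integrable lborel F" and F0: "\<And>s. s \<notin> {c<..<d} \<Longrightarrow> F s = 0"
    and meas: "(\<lambda>u. indicator {a<..<b} u * (F (g u) * g' u)) \<in> borel_measurable borel"
  shows "integrable lborel (\<lambda>u. indicator {a<..<b} u * (F (g u) * g' u))"
    and "(\<integral>u. indicator {a<..<b} u * (F (g u) * g' u) \<partial>lborel) = integral\<^sup>L lborel F"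
proof -
  let ?h = "\<lambda>u. indicator {a<..<b} u * (F (g u) * g' u)"
  have Fi: "indicator {c<..<d} s *\<^sub>R F s = F s" for s
    using F0[of s] by (auto simp: indicator_def)
  have "integrable lebesgue F"
    using F by (simp add: integrable_completion)
  then have 1: "F absolutely_integrable_on {c<..<d}"
    unfolding set_integrable_def Fi .
  have 2: "integral {c<..<d} F = integral\<^sup>L lborel F"
    using F set_borel_integral_eq_integral(2)[of "{c<..<d}" F]
    unfolding set_integrable_def set_lebesgue_integral_def Fi by simp
  have "(\<lambda>x. \<bar>g' x\<bar> * F (g x)) absolutely_integrable_on {a<..<b} \<and>
     integral {a<..<b} (\<lambda>x. \<bar>g' x\<bar> * F (g x)) = integral\<^sup>L lborel F"
    using 1 2 inj der unfolding img[symmetric]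
    by (subst has_absolute_integral_change_of_variables_1')
       (auto intro: has_field_derivative_at_within)
  then have 3: "(\<lambda>x. \<bar>g' x\<bar> * F (g x)) absolutely_integrable_on {a<..<b}"
    and 4: "integral {a<..<b} (\<lambda>x. \<bar>g' x\<bar> * F (g x)) = integral\<^sup>L lborel F"
    by auto
  have eq: "(\<lambda>x. indicator {a<..<b} x *\<^sub>R (\<bar>g' x\<bar> * F (g x))) = ?h"
    using pos by (auto simp: indicator_def fun_eq_iff)
  have "integrable lebesgue ?h"
    using 3 unfolding set_integrable_def eq .
  moreover have m: "?h \<in> borel_measurable lborel" using meas by simp
  ultimately show "integrable lborel ?h"
    using integrable_completion[OF m] by simp
  have "integral\<^sup>L lborel ?h = integral\<^sup>L lebesgue ?h"
    using integral_completion[OF m] by simp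
  also have "\<dots> = integral {a<..<b} (\<lambda>x. \<bar>g' x\<bar> * F (g x))"
    using set_lebesgue_integral_eq_integral(2)[OF 3]
    unfolding set_lebesgue_integral_def eq .
  finally show "integral\<^sup>L lborel ?h = integral\<^sup>L lborel F" using 4 by simp
qed

section \<open>The Sonin integral of the cut-off kernels\<close>

text \<open>
  The kernels are arbitrary outside \<open>{0<..L}\<close>; cutting them off there makes them measurable and
  lets all convolutions be integrals over the whole line.
\<close>
definition cutoff :: "real \<Rightarrow> (real \<Rightarrow> real) \<Rightarrow> real \<Rightarrow> real" where
  "cutoff L F z = indicator {0<..L} z * F z"

lemma cutoff_measurable:
  "F \<in> C_minus1 L \<Longrightarrow> cutoff L F \<in> borel_measurable borel"
  unfolding cutoff_def[abs_def] by (rule C_minus1_measurable)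

text \<open>For \<open>0 < y \<le> L\<close>, both arguments lie in \<open>{0<..L}\<close> exactly
  when \<open>0 < z < y\<close>, so the whole-line integrand is the one of the Sonin
  condition.\<close>

lemma sonin_cutoff:
  assumes "(M, K) \<in> luchko_set L" "y \<in> {0<..L}"
  shows "integrable lborel (\<lambda>z. cutoff L M (y - z) * cutoff L K z)"
    and "(\<integral>z. cutoff L M (y - z) * cutoff L K z \<partial>lborel) = 1"
proof -
  have eq: "(\<lambda>z. cutoff L M (y - z) * cutoff L K z)
      = (\<lambda>z. indicator {0<..<y} z *\<^sub>R (M (y - z) * K z))"
    using assms(2) by (auto simp: cutoff_def indicator_def fun_eq_iff)
  show "integrable lborel (\<lambda>z. cutoff L M (y - z) * cutoff L K z)"
    "(\<integral>z. cutoff L M (y - z) * cutoff L K z \<partial>lborel) = 1"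
    using assms unfolding eq luchko_set_def set_integrable_def set_lebesgue_integral_def
    by auto
qed

text \<open>The Sonin condition controls only the signed integral, whereas Fubini's theorem needs
  absolute values. If the kernels are bounded by powers \<open>p\<close> and \<open>q\<close>, the
  Beta integral yields the exponent \<open>s = p + q + 1\<close>, which exceeds -1 because
  \<open>p\<close> and \<open>q\<close> do.\<close>

lemma sonin_cutoff_abs_bound:
  assumes "(M, K) \<in> luchko_set L"
  obtains s C where "s > -1" "C \<ge> 0"
    "\<And>y. y \<in> {0<..L} \<Longrightarrow> (\<integral>z. \<bar>cutoff L M (y - z) * cutoff L K z\<bar> \<partial>lborel) \<le> C * y powr s"
proof -
  obtain p A where p: "p > -1" "A \<ge> 0" "\<And>z. z \<in> {0<..L} \<Longrightarrow> \<bar>M z\<bar> \<le> A * z powr p"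
    using assms C_minus1_bound[of M L] unfolding luchko_set_def by auto
  obtain q B where q: "q > -1" "B \<ge> 0" "\<And>z. z \<in> {0<..L} \<Longrightarrow> \<bar>K z\<bar> \<le> B * z powr q"
    using assms C_minus1_bound[of K L] unfolding luchko_set_def by auto
  have "(\<integral>z. \<bar>cutoff L M (y - z) * cutoff L K z\<bar> \<partial>lborel)
      \<le> A * B * Beta (q + 1) (p + 1) * y powr (p + q + 1)" if y: "y \<in> {0<..L}" for y
  proof -
    have y0: "y > 0" using y by simp
    have "(\<integral>z. \<bar>cutoff L M (y - z) * cutoff L K z\<bar> \<partial>lborel)
       \<le> (\<integral>z. A * B * (indicator {0<..<y} z * ((y - z) powr p * z powr q)) \<partial>lborel)"
    proof (rule integral_mono)
      show "integrable lborel (\<lambda>z. \<bar>cutoff L M (y - z) * cutoff L K z\<bar>)"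
        using sonin_cutoff(1)[OF assms y] by (rule integrable_abs)
      show "integrable lborel (\<lambda>z. A * B * (indicator {0<..<y} z * ((y - z) powr p * z powr q)))"
        by (intro integrable_mult_right beta_integrable(1) p q y0)
      fix z
      show "\<bar>cutoff L M (y - z) * cutoff L K z\<bar>
          \<le> A * B * (indicator {0<..<y} z * ((y - z) powr p * z powr q))"
      proof (cases "z \<in> {0<..<y}")
        case True
        then have "\<bar>M (y - z)\<bar> * \<bar>K z\<bar> \<le> (A * (y - z) powr p) * (B * z powr q)"
          using y p q by (intro mult_mono) auto
        then show ?thesis using True y by (simp add: cutoff_def abs_mult algebra_simps)
      next
        case False
        then show ?thesis by (auto simp: cutoff_def indicator_def)
      qed
    qed
    also have "\<dots> = A * B * Beta (q + 1) (p + 1) * y powr (p + q + 1)"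
      using beta_integrable(2)[OF p(1) q(1) y0] by simp
    finally show ?thesis .
  qed
  \<comment> \<open>Taking the absolute value of the constant makes it nonnegative without a
    discussion of the sign of \<open>Beta\<close>.\<close>
  moreover have "C * y powr s \<le> (\<bar>C\<bar>) * y powr (s::real)" for C y s
    by (intro mult_right_mono) auto
  ultimately have bd: "(\<integral>z. \<bar>cutoff L M (y - z) * cutoff L K z\<bar> \<partial>lborel)
      \<le> \<bar>A * B * Beta (q + 1) (p + 1)\<bar> * y powr (p + q + 1)" if "y \<in> {0<..L}" for y
    using that order_trans by blast
  show thesis
    by (rule that[OF _ _ bd]) (use p q in auto)
qed

section \<open>The left-sided identity at the right end point\<close>

text \<open>Evaluating at the end point \<open>b\<close> is enough: an interior point
  \<open>x\<close> is reached by applying the result on \<open>{a..x}\<close>. The bound by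
  \<open>L\<close> keeps every kernel argument that occurs within the range of the Sonin
  condition.\<close>

lemma GFI_left_GFD_Caputo_left:
  fixes f g g' v :: "real \<Rightarrow> real"
  assumes MK: "(M, K) \<in> luchko_set L" and ab: "a < b"
    and derg: "\<And>x. x \<in> {a..b} \<Longrightarrow> (g has_real_derivative g' x) (at x within {a..b})"
    and g'_pos: "\<And>x. x \<in> {a..b} \<Longrightarrow> g' x > 0"
    and g'_cont: "continuous_on {a<..b} g'"
    and len: "g b - g a \<le> L"
    and f_cont: "continuous_on {a..b} f"
    and r: "r > -1" and v: "continuous_on {a..b} v"
    and derf: "\<And>x. x \<in> {a<..b} \<Longrightarrow>
        (f has_real_derivative (g x - g a) powr r * v x) (at x within {a..b})"
  shows "GFI_left M a g (GFD_Caputo_left K a g f) b = f b - f a"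
proof -
  define I where "I = {a<..<b}"
  have g_cont: "continuous_on {a..b} g"
    using derg DERIV_continuous_on by blast
  have derg_at: "(g has_real_derivative g' x) (at x)" if "x \<in> I" for x
    using derg[of x] that at_within_Icc_at[of a x b] by (simp add: I_def)
  have derf_at: "(f has_real_derivative (g x - g a) powr r * v x) (at x)" if "x \<in> I" for x
    using derf[of x] that at_within_Icc_at[of a x b] by (simp add: I_def)
  have g_less: "g x < g y" if "a \<le> x" "x < y" "y \<le> b" for x y
  proof (rule DERIV_pos_imp_increasing_open[OF that(2)])
    fix z assume "x < z" "z < y"
    then show "\<exists>d. (g has_real_derivative d) (at z) \<and> d > 0"
      using derg_at[of z] g'_pos[of z] that by (auto simp: I_def)
  qed (rule continuous_on_subset[OF g_cont], use that in auto)
  then have g_mono: "strict_mono_on {a..b} g"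
    by (auto simp: strict_mono_on_def)
  have inj: "inj_on g I"
    using strict_mono_on_imp_inj_on[OF g_mono] by (rule inj_on_subset) (auto simp: I_def)
  have img: "g ` I = {g a<..<g b}"
  proof
    show "{g a<..<g b} \<subseteq> g ` I"
    proof
      fix s assume s: "s \<in> {g a<..<g b}"
      then obtain x where "a \<le> x" "x \<le> b" "g x = s"
        using IVT'[of g a s b] g_cont ab by auto
      with s show "s \<in> g ` I" by (force simp: I_def less_le)
    qed
  qed (auto simp: I_def intro!: g_less)
  have deriv_g: "deriv g x = g' x" and deriv_f: "deriv f x = (g x - g a) powr r * v x"
    if "x \<in> I" for x
    using that derg_at derf_at DERIV_imp_deriv by blast+

  define M0 where "M0 = cutoff L M"
  define K0 where "K0 = cutoff L K"
  \<comment> \<open>The factors are extended by 0, which makes them Borel functions on the whole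
    line and the double integrand measurable on the plane.\<close>
  define g0 where "g0 = (\<lambda>u. indicator {a..b} u * g u)"
  define g1 where "g1 = (\<lambda>u. indicator I u * g' u)"
  define f1 where "f1 = (\<lambda>t. indicator I t * ((g t - g a) powr r * v t))"
  \<comment> \<open>The region \<open>a < t < u < b\<close> needs no indicator of its own:
    \<open>f1\<close> and \<open>g1\<close> confine both variables to \<open>I\<close>, and
    \<open>K0\<close> vanishes unless \<open>g t < g u\<close>, which means \<open>t < u\<close>
    because \<open>g\<close> is strictly increasing.\<close>
  define H where "H = (\<lambda>t u. M0 (g b - g0 u) * K0 (g0 u - g0 t) * g1 u * f1 t)"
  have M0[measurable]: "M0 \<in> borel_measurable borel"
    and K0[measurable]: "K0 \<in> borel_measurable borel"
    using MK cutoff_measurable unfolding luchko_set_def M0_def K0_def by auto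
  have [measurable]: "g0 \<in> borel_measurable borel"
    using borel_measurable_continuous_on_indicator[OF _ g_cont] by (simp add: g0_def)
  have "continuous_on I g'"
    by (rule continuous_on_subset[OF g'_cont]) (auto simp: I_def)
  then have [measurable]: "g1 \<in> borel_measurable borel"
    using borel_measurable_continuous_on_indicator[of I g'] by (simp add: g1_def I_def)
  have "continuous_on I (\<lambda>t. (g t - g a) powr r * v t)"
    using g_less by (intro continuous_intros continuous_on_subset[OF g_cont]
        continuous_on_subset[OF v]) (force simp: I_def)+
  then have [measurable]: "f1 \<in> borel_measurable borel"
    using borel_measurable_continuous_on_indicator[of I "\<lambda>t. (g t - g a) powr r * v t"]
    by (simp add: f1_def I_def)
  have H_meas: "case_prod H \<in> borel_measurable (lborel \<Otimes>\<^sub>M lborel)"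
    unfolding H_def by measurable

  \<comment> \<open>This is the inner integrand in the variable \<open>s = g u\<close>. The
    translation \<open>z = s - g t\<close> turns it into the Sonin integrand for the length
    \<open>g b - g t\<close>.\<close>
  define F where "F = (\<lambda>t s. M0 (g b - s) * K0 (s - g t))"
  have gt: "g b - g t \<in> {0<..L}" if "t \<in> I" for t
    using that g_less[of t b] g_less[of a t] len by (auto simp: I_def)
  have F_int: "integrable lborel (F t)" and F_eq: "integral\<^sup>L lborel (F t) = 1"
    and F_abs: "(\<integral>s. \<bar>F t s\<bar> \<partial>lborel)
        = (\<integral>z. \<bar>cutoff L M ((g b - g t) - z) * cutoff L K z\<bar> \<partial>lborel)"
    if t: "t \<in> I" for t
  proof -
    let ?G = "\<lambda>z. cutoff L M ((g b - g t) - z) * cutoff L K z"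
    have FG: "F t = (\<lambda>s. ?G (- g t + 1 * s))"
      by (simp add: F_def M0_def K0_def fun_eq_iff)
    show "integrable lborel (F t)"
      unfolding FG by (intro lborel_integrable_real_affine sonin_cutoff[OF MK gt[OF t]]) simp
    show "integral\<^sup>L lborel (F t) = 1"
      using sonin_cutoff(2)[OF MK gt[OF t]] lborel_integral_real_affine[of 1 ?G "- g t"]
      by (simp add: FG)
    show "(\<integral>s. \<bar>F t s\<bar> \<partial>lborel) = (\<integral>z. \<bar>?G z\<bar> \<partial>lborel)"
      using lborel_integral_real_affine[of 1 "\<lambda>z. \<bar>?G z\<bar>" "- g t"]
      by (simp add: FG)
  qed
  \<comment> \<open>Below \<open>g a\<close> the argument of \<open>K0\<close> is negative, and from
    \<open>g b\<close> on that of \<open>M0\<close> is not positive.\<close>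
  have F0: "F t s = 0" if "t \<in> I" "s \<notin> {g a<..<g b}" for t s
    using that g_less[of a t] by (auto simp: F_def M0_def K0_def cutoff_def indicator_def I_def)
  have sub_eq: "indicator I u * (F t (g u) * g' u) = M0 (g b - g0 u) * K0 (g0 u - g0 t) * g1 u"
    and sub_abs: "indicator I u * (\<bar>F t (g u)\<bar> * g' u)
      = \<bar>M0 (g b - g0 u) * K0 (g0 u - g0 t) * g1 u\<bar>"
    if "t \<in> I" for t u
    using that g'_pos[of u] by (auto simp: F_def g0_def g1_def indicator_def I_def abs_mult)
  have inner_int: "integrable lborel (\<lambda>u. M0 (g b - g0 u) * K0 (g0 u - g0 t) * g1 u)"
    and inner_eq: "(\<integral>u. M0 (g b - g0 u) * K0 (g0 u - g0 t) * g1 u \<partial>lborel) = 1"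
    and inner_abs: "(\<integral>u. \<bar>M0 (g b - g0 u) * K0 (g0 u - g0 t) * g1 u\<bar> \<partial>lborel)
        = (\<integral>s. \<bar>F t s\<bar> \<partial>lborel)"
    if t: "t \<in> I" for t
  proof -
    have pos: "\<And>x. x \<in> I \<Longrightarrow> g' x \<ge> 0"
      using g'_pos by (auto simp: I_def intro: less_imp_le)
    note subst = lborel_substitution[where g = g and g' = g' and a = a and b = b
        and c = "g a" and d = "g b", folded I_def, OF derg_at pos inj img]
    have m1: "(\<lambda>u. indicator I u * (F t (g u) * g' u)) \<in> borel_measurable borel"
      unfolding sub_eq[OF t] by measurable
    have m2: "(\<lambda>u. indicator I u * (\<bar>F t (g u)\<bar> * g' u)) \<in> borel_measurable borel"
      unfolding sub_abs[OF t] by measurable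
    show "integrable lborel (\<lambda>u. M0 (g b - g0 u) * K0 (g0 u - g0 t) * g1 u)"
      using subst(1)[OF _ _ F_int[OF t] F0[OF t] m1] by (simp add: sub_eq[OF t])
    show "(\<integral>u. M0 (g b - g0 u) * K0 (g0 u - g0 t) * g1 u \<partial>lborel) = 1"
      using subst(2)[OF _ _ F_int[OF t] F0[OF t] m1] by (simp add: sub_eq[OF t] F_eq[OF t])
    show "(\<integral>u. \<bar>M0 (g b - g0 u) * K0 (g0 u - g0 t) * g1 u\<bar> \<partial>lborel)
        = (\<integral>s. \<bar>F t s\<bar> \<partial>lborel)"
      using subst(2)[OF _ _ integrable_abs[OF F_int[OF t]] _ m2] F0[OF t]
      by (simp add: sub_abs[OF t])
  qed

  obtain s C where s: "s > -1" "C \<ge> 0" and sC: "\<And>y. y \<in> {0<..L} \<Longrightarrow>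
      (\<integral>z. \<bar>cutoff L M (y - z) * cutoff L K z\<bar> \<partial>lborel) \<le> C * y powr s"
    using sonin_cutoff_abs_bound[OF MK] by blast
  obtain V where V: "V \<ge> 0" "\<And>t. t \<in> {a..b} \<Longrightarrow> \<bar>v t\<bar> \<le> V"
  proof -
    have "bounded (v ` {a..b})"
      using v compact_continuous_image compact_imp_bounded by blast
    then show thesis
      unfolding bounded_pos by (metis image_eqI real_norm_def that less_imp_le)
  qed
  obtain ma Ba where ma: "ma > 0"
    "\<And>t. t \<in> {a..b} \<Longrightarrow> ma * \<bar>t - a\<bar> \<le> \<bar>g t - g a\<bar>"
    "\<And>t. t \<in> {a..b} \<Longrightarrow> \<bar>g t - g a\<bar> \<le> Ba * \<bar>t - a\<bar>"
    using slope_bounds[OF _ g_cont g_mono derg[of a] g'_pos[of a]] ab by auto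
  obtain mb Bb where mb: "mb > 0"
    "\<And>t. t \<in> {a..b} \<Longrightarrow> mb * \<bar>t - b\<bar> \<le> \<bar>g t - g b\<bar>"
    "\<And>t. t \<in> {a..b} \<Longrightarrow> \<bar>g t - g b\<bar> \<le> Bb * \<bar>t - b\<bar>"
    using slope_bounds[OF _ g_cont g_mono derg[of b] g'_pos[of b]] ab by auto
  \<comment> \<open>\<open>Ca\<close> governs the possible singularity of \<open>deriv f\<close> at
    \<open>a\<close>, and \<open>Cb\<close> that of the integrated absolute kernel product at
    \<open>b\<close>.\<close>
  define Ca where "Ca = (ma powr r + Ba powr r) * V"
  define Cb where "Cb = C * (mb powr s + Bb powr s)"
  have f1_le: "\<bar>f1 t\<bar> \<le> Ca * (t - a) powr r" if t: "t \<in> I" for t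
  proof -
    have "(g t - g a) powr r \<le> (ma powr r + Ba powr r) * (t - a) powr r"
      using t ma(1) ma(2,3)[of t] g_less[of a t]
      by (intro powr_le_powr_of_comparable) (auto simp: I_def)
    then have "(g t - g a) powr r * \<bar>v t\<bar> \<le> ((ma powr r + Ba powr r) * (t - a) powr r) * V"
      using t V by (intro mult_mono) (auto simp: I_def)
    then show ?thesis using t by (simp add: f1_def Ca_def abs_mult mult_ac)
  qed
  have F_le: "(\<integral>s. \<bar>F t s\<bar> \<partial>lborel) \<le> Cb * (b - t) powr s" if t: "t \<in> I" for t
  proof -
    have "(g b - g t) powr s \<le> (mb powr s + Bb powr s) * (b - t) powr s"
      using t mb(1) mb(2,3)[of t] g_less[of t b]
      by (intro powr_le_powr_of_comparable) (auto simp: I_def)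
    then have "C * (g b - g t) powr s \<le> C * ((mb powr s + Bb powr s) * (b - t) powr s)"
      using s by (intro mult_left_mono)
    then show ?thesis
      using sC[OF gt[OF t]] F_abs[OF t] by (simp add: Cb_def mult_ac)
  qed
  have norm_H: "(\<integral>u. norm (H t u) \<partial>lborel)
      = (\<integral>u. \<bar>M0 (g b - g0 u) * K0 (g0 u - g0 t) * g1 u\<bar> \<partial>lborel) * \<bar>f1 t\<bar>" for t
    by (simp add: H_def abs_mult)
  have H_int: "integrable (lborel \<Otimes>\<^sub>M lborel) (case_prod H)"
  proof (rule lborel_pair.Fubini_integrable[OF H_meas])
    show "AE t in lborel. integrable lborel (\<lambda>u. case_prod H (t, u))"
    proof (rule AE_I2)
      fix t
      show "integrable lborel (\<lambda>u. case_prod H (t, u))"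
        using inner_int[of t] by (cases "t \<in> I") (auto simp: H_def f1_def)
    qed
    \<comment> \<open>The majorant is a Beta integrand moved to \<open>{a<..<b}\<close>, with
      exponent \<open>s\<close> at \<open>b\<close> and \<open>r\<close> at \<open>a\<close>. Both
      exceed -1, hence it is integrable.\<close>
    let ?W = "\<lambda>t. Ca * Cb * (indicator I t * ((b - t) powr s * (t - a) powr r))"
    have "integrable lborel (\<lambda>z. indicator {0<..<b - a} z * ((b - a - z) powr s * z powr r))"
      using ab s r by (intro beta_integrable(1)) auto
    then have "integrable lborel (\<lambda>t. indicator {0<..<b - a} (- a + 1 * t) *
        ((b - a - (- a + 1 * t)) powr s * (- a + 1 * t) powr r))"
      by (rule lborel_integrable_real_affine) simp
    also have "(\<lambda>t. indicator {0<..<b - a} (- a + 1 * t) *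
        ((b - a - (- a + 1 * t)) powr s * (- a + 1 * t) powr r))
        = (\<lambda>t. indicator I t * ((b - t) powr s * (t - a) powr r))"
      by (auto simp: fun_eq_iff I_def indicator_def)
    finally have "integrable lborel ?W"
      by (rule integrable_mult_right)
    then show "integrable lborel (\<lambda>t. \<integral>u. norm (case_prod H (t, u)) \<partial>lborel)"
    proof (rule Bochner_Integration.integrable_bound)
      show "(\<lambda>t. \<integral>u. norm (case_prod H (t, u)) \<partial>lborel) \<in> borel_measurable lborel"
        using H_meas by measurable
      show "AE t in lborel. norm (\<integral>u. norm (case_prod H (t, u)) \<partial>lborel) \<le> norm (?W t)"
      proof (rule AE_I2)
        fix t
        show "norm (\<integral>u. norm (case_prod H (t, u)) \<partial>lborel) \<le> norm (?W t)"
        proof (cases "t \<in> I")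
          case True
          have "(\<integral>u. norm (H t u) \<partial>lborel) \<le> (Cb * (b - t) powr s) * (Ca * (t - a) powr r)"
            unfolding norm_H inner_abs[OF True]
            using F_le[OF True] f1_le[OF True]
            by (intro mult_mono) (auto intro: order_trans[rotated])
          then have "(\<integral>u. norm (H t u) \<partial>lborel) \<le> ?W t"
            using True by (simp add: mult_ac)
          then show ?thesis by (simp add: norm_H)
        next
          case False
          then show ?thesis by (simp add: H_def f1_def)
        qed
      qed
    qed
  qed

  \<comment> \<open>The inner kernel integral is 1 for \<open>t\<close> in \<open>I\<close>;
    elsewhere \<open>f1 t\<close> is 0 and so are both sides.\<close>
  have H_u: "(\<integral>u. H t u \<partial>lborel) = f1 t" for t
    using inner_eq[of t] by (cases "t \<in> I") (auto simp: H_def f1_def)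
  have GFD: "GFD_Caputo_left K a g f u = (\<integral>t. K0 (g0 u - g0 t) * f1 t \<partial>lborel)"
    if u: "u \<in> I" for u
    unfolding GFD_Caputo_left_def set_lebesgue_integral_def
  proof (rule Bochner_Integration.integral_cong[OF refl])
    fix t
    \<comment> \<open>For \<open>t < u\<close> the kernel argument lies in \<open>{0<..L}\<close>,
      where the cutoff changes nothing. In the other cases \<open>t\<close> is outside the range of
      integration, and on the right \<open>f1 t\<close> is 0 or \<open>K0\<close> has an argument
      that is not positive.\<close>
    consider "t \<notin> I" | "t \<in> I" "t < u" | "t \<in> I" "u = t" | "t \<in> I" "u < t" by fastforce
    then show "indicator {a<..<u} t *\<^sub>R (K (g u - g t) * deriv f t) = K0 (g0 u - g0 t) * f1 t"
    proof cases
      case 2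
      then have "g u - g t \<in> {0<..L}"
        using u g_less[of t u] g_less[of a t] g_less[of u b] len by (auto simp: I_def)
      then show ?thesis
        using 2 u by (simp add: deriv_f K0_def cutoff_def f1_def g0_def) (auto simp: I_def)
    next
      case 4
      then have "g u < g t" using u g_less[of u t] by (auto simp: I_def)
      then show ?thesis
        using 4 u by (auto simp: K0_def cutoff_def f1_def g0_def I_def)
    qed (use u in \<open>auto simp: f1_def I_def K0_def cutoff_def\<close>)
  qed
  have "GFI_left M a g (GFD_Caputo_left K a g f) b = (\<integral>u. (\<integral>t. H t u \<partial>lborel) \<partial>lborel)"
    unfolding GFI_left_def set_lebesgue_integral_def I_def[symmetric]
  proof (rule Bochner_Integration.integral_cong[OF refl])
    fix u
    show "indicator I u *\<^sub>R (M (g b - g u) * GFD_Caputo_left K a g f u * deriv g u)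
        = (\<integral>t. H t u \<partial>lborel)"
    proof (cases "u \<in> I")
      case True
      have "(\<integral>t. H t u \<partial>lborel)
          = (\<integral>t. (M0 (g b - g0 u) * g1 u) * (K0 (g0 u - g0 t) * f1 t) \<partial>lborel)"
        by (simp add: H_def mult_ac)
      also have "\<dots> = (M0 (g b - g0 u) * g1 u) * GFD_Caputo_left K a g f u"
        by (simp add: GFD[OF True])
      finally show ?thesis
        using True gt[OF True]
        by (simp add: deriv_g M0_def cutoff_def g1_def g0_def) (simp add: I_def)
    qed (simp add: H_def g1_def)
  qed
  also have "\<dots> = (\<integral>t. (\<integral>u. H t u \<partial>lborel) \<partial>lborel)"
    using lborel_pair.Fubini_integral[OF H_int] .
  also have "\<dots> = integral\<^sup>L lborel f1"
    by (simp add: H_u)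
  also have "\<dots> = f b - f a"
  proof -
    \<comment> \<open>Lebesgue integrability of \<open>f1\<close> is inherited from
      \<open>H\<close>, as \<open>f1\<close> is its integral over \<open>u\<close>. The value then
      comes from the gauge integral: the fundamental theorem asks for continuity of \<open>f\<close>
      on the closed interval and for the derivative in the interior only, so \<open>deriv f\<close>
      may be unbounded near \<open>a\<close>.\<close>
    have "integrable lborel f1"
      using lborel_pair.integrable_fst[OF H_int] by (simp add: H_u)
    then have 1: "(f1 has_integral integral\<^sup>L lborel f1) UNIV"
      by (rule has_integral_integral_lborel)
    have "((\<lambda>t. (g t - g a) powr r * v t) has_integral f b - f a) {a..b}"
      using ab f_cont derf_at
      by (intro fundamental_theorem_of_calculus_interior)
         (auto simp: I_def has_real_derivative_iff_has_vector_derivative)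
    then have "((\<lambda>t. (g t - g a) powr r * v t) has_integral f b - f a) I"
      by (simp add: has_integral_Icc_iff_Ioo I_def)
    then have "((\<lambda>t. if t \<in> I then (g t - g a) powr r * v t else 0) has_integral f b - f a) UNIV"
      by (simp only: has_integral_restrict_UNIV)
    also have "(\<lambda>t. if t \<in> I then (g t - g a) powr r * v t else 0) = f1"
      by (auto simp: f1_def)
    finally show ?thesis using has_integral_unique[OF 1] by blast
  qed
  finally show ?thesis .
qed

section \<open>Positivity of the derivative of g\<close>

text \<open>Differentiability at the end points gives continuity there, and a continuous function
  whose derivative is nonnegative in the interior is increasing up to the end points.\<close>

lemma mono_on_Icc_of_mono_on_Ioo:
  fixes g :: "real \<Rightarrow> real"
  assumes mono: "mono_on {a<..<b} g"
    and der: "\<And>x. x \<in> {a..b} \<Longrightarrow> (g has_real_derivative g' x) (at x within {a..b})"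
  shows "mono_on {a..b} g"
proof (rule mono_onI)
  fix y z assume yz: "y \<in> {a..b}" "z \<in> {a..b}" "y \<le> z"
  show "g y \<le> g z"
  proof (rule DERIV_nonneg_imp_increasing_open[OF yz(3)])
    have "continuous_on {a..b} g"
      using der DERIV_continuous_on by blast
    then show "continuous_on {y..z} g"
      by (rule continuous_on_subset) (use yz in auto)
    fix t assume t: "y < t" "t < z"
    have "(g has_real_derivative g' t) (at t)"
      using der[of t] t yz at_within_Icc_at[of a t b] by simp
    moreover from this have "g' t \<ge> 0"
      using mono_on_imp_deriv_nonneg[OF mono] t yz by simp
    ultimately show "\<exists>d. (g has_real_derivative d) (at t) \<and> d \<ge> 0" by blast
  qed
qed

text \<open>Difference quotients of an increasing function are nonnegative, and so is their limit.
  This includes the one-sided derivatives at the end points.\<close>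

lemma deriv_pos_of_mono_on:
  fixes g :: "real \<Rightarrow> real"
  assumes ab: "a < b" and mono: "mono_on {a..b} g" and x: "x \<in> {a..b}"
    and der: "(g has_real_derivative D) (at x within {a..b})" and nz: "D \<noteq> 0"
  shows "D > 0"
proof -
  have lim: "((\<lambda>y. (g y - g x) / (y - x)) \<longlongrightarrow> D) (at x within {a..b})"
    using der by (simp add: has_field_derivative_iff)
  have "0 \<le> (g y - g x) / (y - x)" if "y \<in> {a..b}" for y
    using mono_onD[OF mono, of x y] mono_onD[OF mono, of y x] that x by (cases "x \<le> y") (auto simp: divide_nonpos_nonpos)
  then have "\<forall>\<^sub>F y in at x within {a..b}. 0 \<le> (g y - g x) / (y - x)"
    by (auto simp: eventually_at_filter)
  moreover have "at x within {a..b} \<noteq> bot"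
    using x ab by (simp add: trivial_limit_within islimpt_Icc)
  ultimately have "D \<ge> 0"
    by (rule tendsto_lowerbound[OF lim])
  with nz show ?thesis by simp
qed

section \<open>Reflection of the operators\<close>

lemma has_real_derivative_reflect:
  fixes h :: "real \<Rightarrow> real"
  assumes "(h has_real_derivative D) (at (- w) within {c..d})"
  shows "((\<lambda>w. h (- w)) has_real_derivative - D) (at w within {- d..- c})"
proof -
  have "((\<lambda>w. - w) has_real_derivative -1) (at w within {- d..- c})"
    by (auto intro!: derivative_eq_intros)
  then have "(h \<circ> (\<lambda>w. - w) has_real_derivative D * (-1)) (at w within {- d..- c})"
    using assms by (intro DERIV_image_chain) simp_all
  then show ?thesis by (simp add: o_def)
qed

lemma deriv_reflect:
  fixes h :: "real \<Rightarrow> real"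
  assumes "h differentiable at (- w)"
  shows "deriv (\<lambda>w. h (- w)) w = - deriv h (- w)"
  using assms DERIV_deriv_iff_real_differentiable[of h "- w"] DERIV_mirror[of h "deriv h (- w)" w]
    DERIV_imp_deriv by blast

lemma set_integral_reflect_Ioo:
  fixes h :: "real \<Rightarrow> real"
  shows "(LBINT t:{c<..<d}. h t) = (LBINT w:{- d<..<- c}. h (- w))"
proof -
  have "{x. - x \<in> {c<..<d}} = {- d<..<- c}" by auto
  then show ?thesis using set_integral_reflect[of "{c<..<d}" h] by simp
qed

text \<open>The chain rule for \<open>f (- w)\<close> produces a minus sign, which is the one in
  front of the right-sided derivative. With \<open>- g (- w)\<close> in place of \<open>g\<close>,
  the kernel argument keeps its form.\<close>

lemma GFD_Caputo_right_reflect: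
  assumes "\<And>t. t \<in> {x<..<b} \<Longrightarrow> f differentiable at t"
  shows "GFD_Caputo_right K b g f x
    = GFD_Caputo_left K (- b) (\<lambda>w. - g (- w)) (\<lambda>w. f (- w)) (- x)"
proof -
  have "GFD_Caputo_right K b g f x
      = (LBINT w:{- b<..<- x}. - (K (g (- w) - g x) * deriv f (- w)))"
    unfolding GFD_Caputo_right_def
    by (subst set_integral_reflect_Ioo) (simp add: set_lebesgue_integral_def)
  also have "\<dots> = (LBINT w:{- b<..<- x}. K (- g (- (- x)) - - g (- w)) * deriv (\<lambda>w. f (- w)) w)"
    by (intro set_lebesgue_integral_cong) (auto simp: deriv_reflect assms)
  finally show ?thesis by (simp only: GFD_Caputo_left_def)
qed

text \<open>The two sign changes in \<open>- g (- w)\<close> cancel in its derivative, so the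
  integral operator acquires no sign.\<close>

lemma GFI_right_reflect:
  assumes "\<And>t. t \<in> {x<..<b} \<Longrightarrow> g differentiable at t"
    and "\<And>t. t \<in> {x<..<b} \<Longrightarrow> h t = k (- t)"
  shows "GFI_right M b g h x = GFI_left M (- b) (\<lambda>w. - g (- w)) k (- x)"
proof -
  have "deriv (\<lambda>w. - g (- w)) w = deriv g (- w)" if w: "w \<in> {- b<..<- x}" for w
  proof -
    obtain D where "(g has_real_derivative D) (at (- w))"
      using assms(1)[of "- w"] w by (auto simp: real_differentiable_def)
    then have "((\<lambda>w. - g (- w)) has_real_derivative D) (at w)" "deriv g (- w) = D"
      using DERIV_mirror[of g D w] DERIV_minus[of "\<lambda>w. g (- w)" "- D" w] DERIV_imp_deriv
      by auto
    then show ?thesis using DERIV_imp_deriv by blast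
  qed
  then show ?thesis
    unfolding GFI_right_def GFI_left_def
    by (subst set_integral_reflect_Ioo, intro set_lebesgue_integral_cong) (auto simp: assms(2))
qed

section \<open>The two inversion formulas\<close>

text \<open>Both identities come from the left-sided one at a right end point, on
  \<open>{a..x}\<close> and, after reflection, on \<open>{- b..- x}\<close>. The minus sign in
  \<open>GFD_Caputo_right\<close> stays in front of the double integral, whence the right-sided
  value is \<open>f x - f b\<close>, the negative of \<open>f b - f x\<close>.\<close>

theorem theorem4:
  fixes M K :: "real \<Rightarrow> real" and a b L :: real
  assumes "(M, K) \<in> luchko_set L"
    and "a < b"
  shows "(\<forall>g f. g \<in> G_left a b \<and> g b - g a \<le> L \<and> f \<in> C1_minus1_left g a b \<longrightarrow>
            (\<forall>x\<in>{a<..b}. GFI_left M a g (GFD_Caputo_left K a g f) x = f x - f a)) \<and>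
         (\<forall>g f. g \<in> G_right a b \<and> g b - g a \<le> L \<and> f \<in> C1_minus1_right g a b \<longrightarrow>
            (\<forall>x\<in>{a..<b}. GFI_right M b g (GFD_Caputo_right K b g f) x = f x - f b))"
proof (intro conjI allI impI ballI; elim conjE)
  fix g f x
  assume g: "g \<in> G_left a b" and len: "g b - g a \<le> L" and f: "f \<in> C1_minus1_left g a b"
    and x: "x \<in> {a<..b}"
  obtain g' where mono_Ioo: "mono_on {a<..<b} g"
    and derg: "\<And>x. x \<in> {a..b} \<Longrightarrow> (g has_real_derivative g' x) (at x within {a..b})"
    and g'_cont: "continuous_on {a<..b} g'" and nz: "\<And>x. x \<in> {a..b} \<Longrightarrow> g' x \<noteq> 0"
    using g unfolding G_left_def by blast
  note mono = mono_on_Icc_of_mono_on_Ioo[OF mono_Ioo derg]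
  note g'_pos = deriv_pos_of_mono_on[OF assms(2) mono _ derg nz]
  obtain p v where f_cont: "continuous_on {a..b} f" and p: "p > -1"
    and v: "continuous_on {a..b} v" and derf: "\<And>x. x \<in> {a<..b} \<Longrightarrow>
      (f has_real_derivative (g x - g a) powr p * v x) (at x within {a..b})"
    using f unfolding C1_minus1_left_def by blast
  have "g x \<le> g b"
    using mono_onD[OF mono] x by auto
  then have len': "g x - g a \<le> L" using len by simp
  show "GFI_left M a g (GFD_Caputo_left K a g f) x = f x - f a"
    by (rule GFI_left_GFD_Caputo_left[where g' = g' and r = p and v = v, OF assms(1)])
      (use x g'_pos p len' in \<open>auto intro!: DERIV_subset[OF derg] DERIV_subset[OF derf]
        continuous_on_subset[OF g'_cont] continuous_on_subset[OF f_cont] continuous_on_subset[OF v]\<close>)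
next
  fix g f x
  assume g: "g \<in> G_right a b" and len: "g b - g a \<le> L" and f: "f \<in> C1_minus1_right g a b"
    and x: "x \<in> {a..<b}"
  obtain g' where mono_Ioo: "mono_on {a<..<b} g"
    and derg: "\<And>x. x \<in> {a..b} \<Longrightarrow> (g has_real_derivative g' x) (at x within {a..b})"
    and g'_cont: "continuous_on {a..<b} g'" and nz: "\<And>x. x \<in> {a..b} \<Longrightarrow> g' x \<noteq> 0"
    using g unfolding G_right_def by blast
  note mono = mono_on_Icc_of_mono_on_Ioo[OF mono_Ioo derg]
  note g'_pos = deriv_pos_of_mono_on[OF assms(2) mono _ derg nz]
  obtain q v where f_cont: "continuous_on {a..b} f" and q: "q > -1"
    and v: "continuous_on {a..b} v" and derf: "\<And>x. x \<in> {a..<b} \<Longrightarrow>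
      (f has_real_derivative (g b - g x) powr q * v x) (at x within {a..b})"
    using f unfolding C1_minus1_right_def by blast
  have "g a \<le> g x"
    using mono_onD[OF mono] x by auto
  then have len': "g b - g x \<le> L" using len by simp
  have diff: "g differentiable at t" "f differentiable at t" if "t \<in> {x<..<b}" for t
    using derg[of t] derf[of t] that x at_within_Icc_at[of a t b]
    by (auto simp: real_differentiable_def)
  have "GFI_right M b g (GFD_Caputo_right K b g f) x
      = GFI_left M (- b) (\<lambda>w. - g (- w))
          (GFD_Caputo_left K (- b) (\<lambda>w. - g (- w)) (\<lambda>w. f (- w))) (- x)"
    by (intro GFI_right_reflect diff GFD_Caputo_right_reflect) auto
  also have "\<dots> = f (- (- x)) - f (- (- b))"
  \<comment> \<open>Reflection keeps the sign of the derivative of \<open>g\<close> but reverses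
    that of \<open>f\<close>, hence \<open>- v (- w)\<close>. The factor
    \<open>g b - g (- w)\<close> is already the increment of \<open>- g (- w)\<close> from the left
    end point \<open>- b\<close>.\<close>
  proof (rule GFI_left_GFD_Caputo_left[where g' = "\<lambda>w. g' (- w)" and r = q
        and v = "\<lambda>w. - v (- w)", OF assms(1)])
    fix w assume w: "w \<in> {- b..- x}"
    then have "(g has_real_derivative g' (- w)) (at (- w) within {x..b})"
      using x by (intro DERIV_subset[OF derg]) auto
    then show "((\<lambda>w. - g (- w)) has_real_derivative g' (- w)) (at w within {- b..- x})"
      using DERIV_minus[OF has_real_derivative_reflect] by fastforce
    show "g' (- w) > 0" using w x g'_pos by auto
  next
    fix w assume w: "w \<in> {- b<..- x}"
    then have "(f has_real_derivative (g b - g (- w)) powr q * v (- w)) (at (- w) within {x..b})"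
      using x by (intro DERIV_subset[OF derf]) auto
    from has_real_derivative_reflect[OF this]
    show "((\<lambda>w. f (- w)) has_real_derivative
        (- g (- w) - - g (- (- b))) powr q * (- v (- w))) (at w within {- b..- x})"
      by simp
  next
    show "continuous_on {- b<..- x} (\<lambda>w. g' (- w))"
      using x by (intro continuous_on_compose2[OF g'_cont] continuous_intros) auto
    show "continuous_on {- b..- x} (\<lambda>w. f (- w))"
      using x by (intro continuous_on_compose2[OF f_cont] continuous_intros) auto
    show "continuous_on {- b..- x} (\<lambda>w. - v (- w))"
      using x by (intro continuous_intros continuous_on_compose2[OF v]) auto
  qed (use x q len' in auto)
  finally show "GFI_right M b g (GFD_Caputo_right K b g f) x = f x - f b"
    by simp
qed

end
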